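(* There exists exactly one Markov transition kernel $\mu$ on $[0,\infty)$ with $\mu(0,\{0\})=1$ and $\mu(t,[0,t))=1$ for every $t>0$ (absorbing state $0$ and strictly decreasing paths) such that, for every $t>0$, the chain $(X_n)_{n\ge0}$ with $X_0=t$ satisfies $$P\big(\#\{n\ge1: X_n\in(0,t)\}=j\big)=p_j(t)\qquad\text{for all } j\ge0.$$
   Context: $\sigma_1(k,j)$ are the unsigned Stirling numbers of the first kind ($\sigma_1(k,j)=0$ for $k<j$, $\sigma_1(0,0)=1$); $p_j(t)=e^{-t}\sum_{k=j}^\infty \frac{t^k}{k!}\frac{\sigma_1(k,j)}{k!}$ for $j\ge0$ (these form a probability distribution in $j$ for each $t\ge0$). *)

theory Defs
  imports "HOL-Probability.Probability" "HOL-Combinatorics.Stirling"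
begin

definition S :: "real measure" where
  "S = restrict_space borel {0..}"

text \<open>p_j(t) = e^{-t} \<Sum>_k t^k/k! * sigma_1(k,j)/k!  (stirling = unsigned Stirling numbers of the first kind).\<close>
definition p :: "nat \<Rightarrow> real \<Rightarrow> real" where
  "p j t = exp (- t) * (\<Sum>k. t ^ k / fact k * (real (stirling k j) / fact k))"

definition markov_kernel :: "(real \<Rightarrow> real measure) \<Rightarrow> bool" where
  "markov_kernel \<mu> \<longleftrightarrow> \<mu> \<in> measurable S (prob_algebra S)"

text \<open>Conditional laws for the Ionescu-Tulcea construction of the chain started at t:
  X_0 = t, X_{i} ~ \<mu>(X_{i-1}).\<close>
definition chain_step :: "(real \<Rightarrow> real measure) \<Rightarrow> real \<Rightarrow> nat \<Rightarrow> (nat \<Rightarrow> real) \<Rightarrow> real measure" where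
  "chain_step \<mu> t i \<omega> = (if i = 0 then return S t else \<mu> (\<omega> (i - 1)))"

definition chain_law :: "(real \<Rightarrow> real measure) \<Rightarrow> real \<Rightarrow> (nat \<Rightarrow> real) measure" where
  "chain_law \<mu> t = projective_family.lim UNIV (Ionescu_Tulcea.CI (chain_step \<mu> t) (\<lambda>_. S)) (\<lambda>_. S)"

definition count_event :: "real \<Rightarrow> nat \<Rightarrow> (nat \<Rightarrow> real) set" where
  "count_event t j = {\<omega> \<in> space (PiM UNIV (\<lambda>_. S)).
      finite {n. n \<ge> 1 \<and> \<omega> n \<in> {0<..<t}} \<and> card {n. n \<ge> 1 \<and> \<omega> n \<in> {0<..<t}} = j}"

definition good_kernel :: "(real \<Rightarrow> real measure) \<Rightarrow> bool" where
  "good_kernel \<mu> \<longleftrightarrow> markov_kernel \<mu>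
     \<and> emeasure (\<mu> 0) {0} = 1
     \<and> (\<forall>t>0. emeasure (\<mu> t) {0..<t} = 1)
     \<and> (\<forall>t>0. \<forall>j. measure (chain_law \<mu> t) (count_event t j) = p j t)"

end

theory Submission
  imports Defs
begin

text \<open>
  The unique kernel is the law of \<open>U (t - E)\<^sup>+\<close> with \<open>E\<close> exponential and \<open>U\<close> uniform on \<open>[0, 1]\<close>,
  independent. Paths decrease strictly until they are absorbed at \<open>0\<close>, so the count is \<open>j\<close> iff
  \<open>X\<^sub>j > 0 = X\<^sub>j\<^sub>+\<^sub>1\<close> almost surely, and the condition on \<open>\<mu>\<close> says
  \<open>\<mu>(t, {0}) = p\<^sub>0(t)\<close> and \<open>\<integral>\<^bsub>s > 0\<^esub> p\<^sub>j(s) \<mu>(t, ds) = p\<^sub>j\<^sub>+\<^sub>1(t)\<close>.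

  Existence: with \<open>P\<^sub>j(t) = exp t * p\<^sub>j(t)\<close>, the Stirling recurrence reads
  \<open>(t exp (-t) P\<^sub>j\<^sub>+\<^sub>1'(t))' = p\<^sub>j(t)\<close>. Integrating once averages \<open>p\<^sub>j\<close> over the uniform variable,
  integrating again averages over the exponential one.

  Uniqueness: \<open>\<integral> p\<^sub>j d\<mu>(t, \<cdot>) = \<Sum>\<^sub>k \<sigma>\<^sub>1(k, j) m\<^sub>k / k!\<^sup>2\<close> with \<open>m\<^sub>k = \<integral> exp (-s) s\<^sup>k \<mu>(t, ds)\<close>. Weighting by
  \<open>(-n)\<^sup>j\<close> and summing over \<open>j\<close> turns the Stirling numbers into rising factorials of \<open>-n\<close>, which vanish
  for \<open>k > n\<close>; the system for the \<open>m\<^sub>k\<close> is therefore triangular. The \<open>m\<^sub>k\<close> determine the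
  characteristic function.
\<close>

section \<open>First-step analysis of the chain\<close>

lemma (in Ionescu_Tulcea) nn_integral_lim_restrict:
  assumes f[measurable]: "f \<in> borel_measurable (PiM {0..<n} M)"
  shows "(\<integral>\<^sup>+\<omega>. f (restrict \<omega> {0..<n}) \<partial>PF.lim) = (\<integral>\<^sup>+\<omega>. f \<omega> \<partial>C 0 n (\<lambda>_. undefined))"
proof -
  \<comment> \<open>\<open>CI\<close> on an index set \<open>J\<close> is built from
    \<open>C 0 (up_to J)\<close> and then restricted to \<open>J\<close>. For an initial segment
    this involves no extra coordinates, so the marginal is \<open>C 0 n\<close> itself.\<close>
  have up: "up_to {0..<n} = n"
  proof (rule antisym)
    show "n \<le> up_to {0..<n}"
      by (rule ccontr) (use up_to_less[of "{0..<n}" "up_to {0..<n}"] in auto)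
  qed (simp add: up_to_iff)
  have u: "(\<lambda>_. undefined) \<in> space (PiM {0..<0} M)" by (simp add: space_PiM)
  have r: "(\<lambda>\<omega>. restrict \<omega> {0..<n}) \<in> measurable PF.lim (PiM {0..<n} M)"
    by (simp add: measurable_cong_sets[OF PF.sets_lim refl] measurable_restrict_subset)
  have "(\<integral>\<^sup>+\<omega>. f (restrict \<omega> {0..<n}) \<partial>PF.lim) = (\<integral>\<^sup>+\<omega>. f \<omega> \<partial>distr PF.lim (PiM {0..<n} M) (\<lambda>\<omega>. restrict \<omega> {0..<n}))"
    using r by (subst nn_integral_distr) auto
  also have "\<dots> = (\<integral>\<^sup>+\<omega>. f \<omega> \<partial>C 0 n (\<lambda>_. undefined))"
    using distr_C[of n n "\<lambda>_. undefined" 0] u by (simp add: distr_lim CI_def up)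
  finally show ?thesis .
qed

text \<open>\<open>C 0 (Suc n)\<close> is \<open>C 0 n\<close> bound with \<open>eP n\<close>, so
  the last coordinate can be integrated first, against its conditional law. The inner integral
  depends on the first \<open>n\<close> coordinates only and is carried back to the limit
  measure.\<close>

lemma (in Ionescu_Tulcea) nn_integral_lim_step:
  assumes f[measurable]: "f \<in> borel_measurable (PiM {0..<Suc n} M)"
  shows "(\<integral>\<^sup>+\<omega>. f (restrict \<omega> {0..<Suc n}) \<partial>PF.lim) =
    (\<integral>\<^sup>+\<omega>. (\<integral>\<^sup>+y. f (fun_upd (restrict \<omega> {0..<n}) n y) \<partial>P n (restrict \<omega> {0..<n})) \<partial>PF.lim)"
proof -
  have u: "(\<lambda>_. undefined) \<in> space (PiM {0..<0} M)" by (simp add: space_PiM)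
  have m: "(\<lambda>\<omega>. \<integral>\<^sup>+\<omega>'. f \<omega>' \<partial>eP n \<omega>) \<in> borel_measurable (PiM {0..<n} M)"
    by measurable
  have "(\<integral>\<^sup>+\<omega>. f (restrict \<omega> {0..<Suc n}) \<partial>PF.lim) = (\<integral>\<^sup>+\<omega>. f \<omega> \<partial>C 0 (Suc n) (\<lambda>_. undefined))"
    by (rule nn_integral_lim_restrict) fact
  also have "\<dots> = (\<integral>\<^sup>+\<omega>. \<integral>\<^sup>+\<omega>'. f \<omega>' \<partial>eP n \<omega> \<partial>C 0 n (\<lambda>_. undefined))"
    using u by (simp add: nn_integral_bind[where B="PiM {0..<Suc n} M"] measurable_cong_sets[OF sets_C])
  also have "\<dots> = (\<integral>\<^sup>+\<omega>. \<integral>\<^sup>+\<omega>'. f \<omega>' \<partial>eP n (restrict \<omega> {0..<n}) \<partial>PF.lim)"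
    by (rule nn_integral_lim_restrict[OF m, symmetric])
  also have "\<dots> = (\<integral>\<^sup>+\<omega>. (\<integral>\<^sup>+y. f (fun_upd (restrict \<omega> {0..<n}) n y) \<partial>P n (restrict \<omega> {0..<n})) \<partial>PF.lim)"
    by (intro nn_integral_cong nn_integral_eP) (auto simp: space_PiM PF.space_lim)
  finally show ?thesis .
qed

section \<open>The chain of a Markov kernel on the half-line\<close>

lemma space_S [simp]: "space S = {0..}"
  by (simp add: S_def space_restrict_space)

lemma id_S_borel [measurable]: "(\<lambda>x. x) \<in> borel_measurable S"
  by (simp add: S_def measurable_restrict_space1)

lemma borel_measurable_S_restrict:
  assumes "f \<in> borel_measurable borel"
  shows "f \<in> borel_measurable S"
  using measurable_compose[OF id_S_borel assms] by simp

lemma indicator_S: "A \<in> sets borel \<Longrightarrow> (indicator A :: real \<Rightarrow> ennreal) \<in> borel_measurable S"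
  by (intro borel_measurable_S_restrict) simp

lemma markov_kernelD:
  assumes "markov_kernel \<mu>" "x \<ge> 0"
  shows "prob_space (\<mu> x)" "sets (\<mu> x) = sets S" "space (\<mu> x) = {0..}"
proof -
  have "\<mu> x \<in> space (prob_algebra S)"
    using assms measurable_space[of \<mu> S "prob_algebra S" x] by (simp add: markov_kernel_def)
  then show "prob_space (\<mu> x)" and *: "sets (\<mu> x) = sets S"
    by (auto simp: space_prob_algebra)
  show "space (\<mu> x) = {0..}"
    using sets_eq_imp_space_eq[OF *] by simp
qed

lemma markov_kernel_subprob [measurable (raw)]:
  assumes "markov_kernel \<mu>" shows "\<mu> \<in> measurable S (subprob_algebra S)"
  using assms by (simp add: markov_kernel_def measurable_prob_algebraD)

lemma Ionescu_Tulcea_chain_step: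
  assumes \<mu>: "markov_kernel \<mu>" and t: "t \<ge> 0"
  shows "Ionescu_Tulcea (chain_step \<mu> t) (\<lambda>_. S)"
proof (rule Ionescu_Tulcea.intro)
  show "chain_step \<mu> t i \<in> measurable (PiM {0..<i} (\<lambda>_. S)) (subprob_algebra S)" for i
  proof (cases "i = 0")
    case True
    then show ?thesis
      using t by (simp add: chain_step_def[abs_def] prob_space_return prob_space_imp_subprob_space space_subprob_algebra)
  next
    case False
    have "(\<lambda>\<omega>. \<mu> (\<omega> (i - 1))) \<in> measurable (PiM {0..<i} (\<lambda>_. S)) (subprob_algebra S)"
      by (rule measurable_compose[OF _ markov_kernel_subprob[OF \<mu>]])
        (use False in \<open>auto intro!: measurable_component_singleton\<close>)
    with False show ?thesis by (simp add: chain_step_def[abs_def])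
  qed
  show "prob_space (chain_step \<mu> t i x)" if "x \<in> space (PiM {0..<i} (\<lambda>_. S))" for i x
  proof (cases "i = 0")
    case False
    with that have "x (i - 1) \<ge> 0" by (auto simp: space_PiM PiE_iff)
    with False show ?thesis by (simp add: chain_step_def markov_kernelD(1)[OF \<mu>])
  qed (simp add: chain_step_def prob_space_return t)
qed

lemma
  assumes "markov_kernel \<mu>" "t \<ge> 0"
  shows sets_chain_law: "sets (chain_law \<mu> t) = sets (PiM UNIV (\<lambda>_. S))"
    and space_chain_law: "space (chain_law \<mu> t) = UNIV \<rightarrow>\<^sub>E {0..}"
    and prob_space_chain_law: "prob_space (chain_law \<mu> t)"
proof -
  interpret Ionescu_Tulcea "chain_step \<mu> t" "\<lambda>_. S"
    by (rule Ionescu_Tulcea_chain_step) fact+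
  show "sets (chain_law \<mu> t) = sets (PiM UNIV (\<lambda>_. S))" "space (chain_law \<mu> t) = UNIV \<rightarrow>\<^sub>E {0..}"
    by (simp_all add: chain_law_def PF.sets_lim PF.space_lim space_PiM)
  have u: "(\<lambda>_. undefined) \<in> space (PiM {0..<0::nat} (\<lambda>_. S))" by (simp add: space_PiM)
  \<comment> \<open>The constant 1 depends on no coordinate, so the total mass is that of the law
    \<open>C 0 0\<close> on empty tuples.\<close>
  have "emeasure PF.lim (space PF.lim) = (\<integral>\<^sup>+\<omega>. 1 \<partial>PF.lim)" by simp
  also have "\<dots> = (\<integral>\<^sup>+\<omega>. 1 \<partial>C 0 0 (\<lambda>_. undefined))"
    using nn_integral_lim_restrict[of "\<lambda>_. 1" 0] by simp
  also have "\<dots> = 1"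
    using prob_space.emeasure_space_1[OF prob_space_C[OF u]] by simp
  finally show "prob_space (chain_law \<mu> t)"
    by (intro prob_spaceI) (simp add: chain_law_def)
qed

lemma nn_integral_chain_start:
  assumes \<mu>: "markov_kernel \<mu>" and t: "t \<ge> 0" and g[measurable]: "g \<in> borel_measurable S"
  shows "(\<integral>\<^sup>+\<omega>. g (\<omega> 0) \<partial>chain_law \<mu> t) = g t"
proof -
  interpret Ionescu_Tulcea "chain_step \<mu> t" "\<lambda>_. S"
    by (rule Ionescu_Tulcea_chain_step) fact+
  interpret L: prob_space "chain_law \<mu> t" by (rule prob_space_chain_law) fact+
  have "(\<lambda>\<omega>. g (\<omega> 0)) \<in> borel_measurable (PiM {0..<Suc 0} (\<lambda>_. S))" by measurable
  from nn_integral_lim_step[OF this] have "(\<integral>\<^sup>+\<omega>. g (\<omega> 0) \<partial>PF.lim) = (\<integral>\<^sup>+\<omega>. (\<integral>\<^sup>+y. g y \<partial>return S t) \<partial>PF.lim)"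
    by (simp add: chain_step_def)
  also have "\<dots> = (\<integral>\<^sup>+\<omega>. g t \<partial>PF.lim)"
    using t by (subst nn_integral_return) auto
  also have "\<dots> = g t" using L.emeasure_space_1 by (simp add: chain_law_def)
  finally show ?thesis by (simp add: chain_law_def)
qed

text \<open>The Markov property in one-step form. Together with
  \<open>nn_integral_chain_start\<close> it replaces explicit work with the projective limit when
  the paths and their counts are analysed.\<close>

lemma nn_integral_chain_step:
  assumes \<mu>: "markov_kernel \<mu>" and t: "t \<ge> 0"
    and h[measurable]: "case_prod h \<in> borel_measurable (S \<Otimes>\<^sub>M S)"
  shows "(\<integral>\<^sup>+\<omega>. h (\<omega> n) (\<omega> (Suc n)) \<partial>chain_law \<mu> t) =
    (\<integral>\<^sup>+\<omega>. (\<integral>\<^sup>+y. h (\<omega> n) y \<partial>\<mu> (\<omega> n)) \<partial>chain_law \<mu> t)"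
proof -
  interpret Ionescu_Tulcea "chain_step \<mu> t" "\<lambda>_. S"
    by (rule Ionescu_Tulcea_chain_step) fact+
  have "(\<lambda>\<omega>. h (\<omega> n) (\<omega> (Suc n))) \<in> borel_measurable (PiM {0..<Suc (Suc n)} (\<lambda>_. S))" by measurable
  from nn_integral_lim_step[OF this] show ?thesis
    by (simp add: chain_step_def chain_law_def)
qed

text \<open>There are only countably many finite sets of times, so the event is a countable union
  over the possible sets \<open>F\<close> of visiting times.\<close>

lemma count_event_sets: "count_event t j \<in> sets (PiM UNIV (\<lambda>_. S))"
proof -
  let ?A = "\<lambda>\<omega>::nat \<Rightarrow> real. {n. n \<ge> 1 \<and> \<omega> n \<in> {0<..<t}}"
  have "count_event t j = (\<Union>F\<in>{F. finite F \<and> card F = j}.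
      {\<omega> \<in> space (PiM UNIV (\<lambda>_. S)). \<forall>n. (n \<ge> 1 \<and> \<omega> n \<in> {0<..<t}) = (n \<in> F)})"
    by (auto simp: count_event_def set_eq_iff[symmetric])
  also have "\<dots> \<in> sets (PiM UNIV (\<lambda>_. S))"
  proof (intro sets.countable_UN'')
    show "countable {F :: nat set. finite F \<and> card F = j}"
      by (rule countable_subset[OF _ countable_Collect_finite]) auto
    fix F :: "nat set"
    have [measurable]: "(\<lambda>\<omega>. \<omega> n) \<in> borel_measurable (PiM UNIV (\<lambda>_. S))" for n
      by (rule measurable_compose[OF _ id_S_borel]) measurable
    show "{\<omega> \<in> space (PiM UNIV (\<lambda>_. S)). \<forall>n. (n \<ge> 1 \<and> \<omega> n \<in> {0<..<t}) = (n \<in> F)} \<in> sets (PiM UNIV (\<lambda>_. S))"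
      by measurable
  qed
  finally show ?thesis .
qed

text \<open>The probability that the chain from \<open>x\<close> is positive at time
  \<open>j\<close> and zero at time \<open>j + 1\<close>, written as an iterated integral. The
  indicator prevents a chain already at 0 from being counted as leaving the positive states.\<close>

primrec level_prob :: "(real \<Rightarrow> real measure) \<Rightarrow> nat \<Rightarrow> real \<Rightarrow> ennreal" where
  "level_prob \<mu> 0 x = emeasure (\<mu> x) {0} * indicator {0<..} x"
| "level_prob \<mu> (Suc j) x = (\<integral>\<^sup>+y. level_prob \<mu> j y \<partial>\<mu> x)"

lemma measurable_level_prob:
  assumes \<mu>: "markov_kernel \<mu>"
  shows "level_prob \<mu> j \<in> borel_measurable S"
proof (induction j)
  case 0
  have [measurable]: "(indicator {0<..} :: real \<Rightarrow> ennreal) \<in> borel_measurable S"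
    by (rule indicator_S) simp
  have [measurable]: "{0} \<in> sets S"
    by (auto simp: S_def sets_restrict_space_iff)
  note markov_kernel_subprob[OF \<mu>, measurable]
  have "(\<lambda>x. emeasure (\<mu> x) {0} * indicator {0<..} x) \<in> borel_measurable S" by measurable
  then show ?case by (simp add: level_prob.simps[abs_def])
next
  case (Suc j)
  note Suc[measurable] markov_kernel_subprob[OF \<mu>, measurable]
  have "(\<lambda>x. (\<integral>\<^sup>+y. level_prob \<mu> j y \<partial>\<mu> x)) \<in> borel_measurable S" by measurable
  then show ?case by (simp add: level_prob.simps[abs_def])
qed

section \<open>Almost sure shape of the paths and the law of the count\<close>

locale decreasing_kernel =
  fixes \<mu> :: "real \<Rightarrow> real measure"
  assumes markov: "markov_kernel \<mu>"
    and absorbing: "emeasure (\<mu> 0) {0} = 1"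
    and decreasing: "t > 0 \<Longrightarrow> emeasure (\<mu> t) {0..<t} = 1"
begin

lemma sets_kernel: "x \<ge> 0 \<Longrightarrow> A \<in> sets borel \<Longrightarrow> A \<subseteq> {0..} \<Longrightarrow> A \<in> sets (\<mu> x)"
  using markov_kernelD(2)[OF markov] by (simp add: S_def sets_restrict_space_iff)

lemma AE_absorbing: "AE y in \<mu> 0. y = 0"
proof -
  interpret prob_space "\<mu> 0" by (rule markov_kernelD[OF markov]) simp
  from absorbing have "prob {0} = 1" by (simp add: measure_def)
  from prob_eq_1[THEN iffD1, OF _ this] sets_kernel[of 0 "{0}"] show ?thesis by simp
qed

lemma AE_decreasing: assumes "x > 0" shows "AE y in \<mu> x. 0 \<le> y \<and> y < x"
proof -
  interpret prob_space "\<mu> x" using assms by (intro markov_kernelD[OF markov]) simp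
  from decreasing[OF assms] have "prob {0..<x} = 1" by (simp add: measure_def)
  moreover have "{0..<x} \<in> events" using assms by (intro sets_kernel) auto
  ultimately show ?thesis using prob_eq_1[of "{0..<x}"] by simp
qed

lemma AE_step: assumes "x \<ge> 0" shows "AE y in \<mu> x. 0 \<le> y \<and> (y < x \<or> x = 0 \<and> y = 0)"
proof (cases "x = 0")
  case True
  with AE_absorbing show ?thesis by (auto elim: eventually_mono)
next
  case False
  with AE_decreasing[of x] assms show ?thesis by (auto elim: eventually_mono)
qed

lemma level_prob_at_0: "level_prob \<mu> j 0 = 0"
proof (induction j)
  case (Suc j)
  interpret prob_space "\<mu> 0" by (rule markov_kernelD[OF markov]) simp
  have "level_prob \<mu> (Suc j) 0 = (\<integral>\<^sup>+y. 0 \<partial>\<mu> 0)"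
    unfolding level_prob.simps using AE_absorbing Suc by (intro nn_integral_cong_AE) auto
  then show ?case by simp
qed simp

text \<open>Each forbidden transition has probability zero under the kernel, hence under the chain
  at each time; there are only countably many times.\<close>

lemma AE_chain_path:
  assumes t: "t \<ge> 0"
  shows "AE \<omega> in chain_law \<mu> t. \<omega> 0 = t \<and> (\<forall>n. 0 \<le> \<omega> n \<and> (\<omega> (Suc n) < \<omega> n \<or> \<omega> n = 0 \<and> \<omega> (Suc n) = 0))"
proof -
  note sets_chain_law[OF markov t, measurable_cong]
  have [measurable]: "(\<lambda>\<omega>. \<omega> n) \<in> borel_measurable (PiM UNIV (\<lambda>_. S))" for n
    by (rule measurable_compose[OF _ id_S_borel]) measurable
  have start: "AE \<omega> in chain_law \<mu> t. \<omega> 0 = t"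
  proof -
    have "(\<integral>\<^sup>+\<omega>. indicator {\<omega>. \<omega> 0 \<noteq> t} \<omega> \<partial>chain_law \<mu> t) = (\<integral>\<^sup>+\<omega>. indicator (- {t}) (\<omega> 0) \<partial>chain_law \<mu> t)"
      by (intro nn_integral_cong) (auto split: split_indicator)
    also have "\<dots> = 0"
      using t by (subst nn_integral_chain_start[OF markov]) (auto intro!: borel_measurable_S_restrict)
    finally have "AE \<omega> in chain_law \<mu> t. indicator {\<omega>. \<omega> 0 \<noteq> t} \<omega> = (0::ennreal)"
      by (subst nn_integral_0_iff_AE[symmetric]) auto
    then show ?thesis by (auto simp: indicator_def split: if_splits)
  qed
  have step: "AE \<omega> in chain_law \<mu> t. \<omega> (Suc n) < \<omega> n \<or> \<omega> n = 0 \<and> \<omega> (Suc n) = 0" for n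
  proof -
    \<comment> \<open>\<open>h\<close> is the indicator of a forbidden transition.\<close>
    define h :: "real \<Rightarrow> real \<Rightarrow> ennreal" where "h x y = (if y < x \<or> x = 0 \<and> y = 0 then 0 else 1)" for x y
    have [measurable]: "case_prod h \<in> borel_measurable (S \<Otimes>\<^sub>M S)"
    proof -
      have [measurable]: "fst \<in> borel_measurable (S \<Otimes>\<^sub>M S)" "snd \<in> borel_measurable (S \<Otimes>\<^sub>M S)"
        by (rule measurable_compose[OF _ id_S_borel]; measurable)+
      show ?thesis unfolding h_def case_prod_beta by measurable
    qed
    have "(\<integral>\<^sup>+\<omega>. h (\<omega> n) (\<omega> (Suc n)) \<partial>chain_law \<mu> t) = (\<integral>\<^sup>+\<omega>. (\<integral>\<^sup>+y. h (\<omega> n) y \<partial>\<mu> (\<omega> n)) \<partial>chain_law \<mu> t)"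
      by (rule nn_integral_chain_step[OF markov t]) measurable
    also have "\<dots> = (\<integral>\<^sup>+\<omega>. 0 \<partial>chain_law \<mu> t)"
    proof (intro nn_integral_cong)
      fix \<omega> assume "\<omega> \<in> space (chain_law \<mu> t)"
      then have "\<omega> n \<ge> 0" by (auto simp: space_chain_law[OF markov t])
      from AE_step[OF this] have "(\<integral>\<^sup>+y. h (\<omega> n) y \<partial>\<mu> (\<omega> n)) = (\<integral>\<^sup>+y. 0 \<partial>\<mu> (\<omega> n))"
        by (intro nn_integral_cong_AE) (auto simp: h_def)
      then show "(\<integral>\<^sup>+y. h (\<omega> n) y \<partial>\<mu> (\<omega> n)) = 0" by simp
    qed
    finally have "AE \<omega> in chain_law \<mu> t. h (\<omega> n) (\<omega> (Suc n)) = 0"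
      by (subst nn_integral_0_iff_AE[symmetric]) auto
    then show ?thesis by (auto simp: h_def split: if_splits)
  qed
  have "AE \<omega> in chain_law \<mu> t. \<forall>n. 0 \<le> \<omega> n"
    by (rule AE_I2) (auto simp: space_chain_law[OF markov t])
  moreover have "AE \<omega> in chain_law \<mu> t. \<forall>n. \<omega> (Suc n) < \<omega> n \<or> \<omega> n = 0 \<and> \<omega> (Suc n) = 0"
    using step by (simp add: AE_all_countable)
  ultimately show ?thesis using start by eventually_elim auto
qed

text \<open>Removing the last time step integrates \<open>level_prob\<close> once against the kernel
  and raises its level by one. The induction on \<open>n\<close> therefore needs \<open>i\<close>
  arbitrary.\<close>

lemma nn_integral_level_prob:
  assumes t: "t \<ge> 0"
  shows "(\<integral>\<^sup>+\<omega>. level_prob \<mu> i (\<omega> n) \<partial>chain_law \<mu> t) = level_prob \<mu> (i + n) t"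
proof (induction n arbitrary: i)
  case 0
  show ?case using nn_integral_chain_start[OF markov t measurable_level_prob[OF markov]] by simp
next
  case (Suc n)
  have "(\<integral>\<^sup>+\<omega>. level_prob \<mu> i (\<omega> (Suc n)) \<partial>chain_law \<mu> t) = (\<integral>\<^sup>+\<omega>. level_prob \<mu> (Suc i) (\<omega> n) \<partial>chain_law \<mu> t)"
    using nn_integral_chain_step[OF markov t, of "\<lambda>_. level_prob \<mu> i" n] measurable_level_prob[OF markov]
    by simp
  with Suc[of "Suc i"] show ?case by simp
qed

text \<open>From time 1 on the path stays below \<open>t\<close>, so only positivity matters. A
  strictly decreasing path absorbed at 0 is positive exactly up to its last positive time
  \<open>k\<close>, and time 0 is not counted, so the count is \<open>k\<close>.\<close>

lemma count_iff_exit: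
  assumes t: "t > 0" and 0: "\<omega> 0 = t"
    and path: "\<And>n. 0 \<le> \<omega> n \<and> (\<omega> (Suc n) < \<omega> n \<or> \<omega> n = 0 \<and> \<omega> (Suc n) = 0)"
  shows "finite {n. n \<ge> 1 \<and> \<omega> n \<in> {0<..<t}} \<and> card {n. n \<ge> 1 \<and> \<omega> n \<in> {0<..<t}} = j
    \<longleftrightarrow> \<omega> j > 0 \<and> \<omega> (Suc j) = (0::real)"
proof -
  have dec: "decseq \<omega>" using path by (intro decseq_SucI) (metis order.order_iff_strict)
  have lt: "\<omega> n < t" if "n \<ge> 1" for n
  proof -
    have "\<omega> n \<le> \<omega> 1" using dec that by (auto simp: decseq_def)
    moreover have "\<omega> 1 < t" using path[of 0] 0 t by auto
    ultimately show ?thesis by simp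
  qed
  have eq: "{n. n \<ge> 1 \<and> \<omega> n \<in> {0<..<t}} = {n. n \<ge> 1 \<and> \<omega> n > 0}" using lt by auto
  have *: "{n. n \<ge> 1 \<and> \<omega> n > 0} = {1..k}" if "\<omega> k > 0" "\<omega> (Suc k) = 0" for k
  proof (intro set_eqI iffI; clarsimp)
    fix n assume "Suc 0 \<le> n" "0 < \<omega> n"
    then show "n \<le> k" using decseqD[OF dec, of "Suc k" n] that by (cases "n \<le> k") auto
  next
    fix n assume "Suc 0 \<le> n" "n \<le> k"
    then show "0 < \<omega> n" using decseqD[OF dec, of n k] that by auto
  qed
  show ?thesis
  proof
    assume "\<omega> j > 0 \<and> \<omega> (Suc j) = 0"
    then show "finite {n. n \<ge> 1 \<and> \<omega> n \<in> {0<..<t}} \<and> card {n. n \<ge> 1 \<and> \<omega> n \<in> {0<..<t}} = j"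
      using *[of j] eq by simp
  next
    assume fc: "finite {n. n \<ge> 1 \<and> \<omega> n \<in> {0<..<t}} \<and> card {n. n \<ge> 1 \<and> \<omega> n \<in> {0<..<t}} = j"
    \<comment> \<open>A path that never reaches 0 would have an infinite count.\<close>
    have "\<exists>m. \<omega> m = 0"
    proof (rule ccontr)
      assume "\<not> ?thesis"
      then have "\<omega> n > 0" for n using path[of n] by (metis order.order_iff_strict)
      then have "{n. n \<ge> 1 \<and> \<omega> n > 0} = {1..}" by auto
      with fc eq show False using infinite_Ici by auto
    qed
    \<comment> \<open>The first zero \<open>m\<close> is not 0 because the path starts at
      \<open>t > 0\<close>; its predecessor is the last positive time.\<close>
    then obtain m where "\<omega> m = 0" and least: "\<And>i. i < m \<Longrightarrow> \<omega> i \<noteq> 0"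
      using exists_least_iff[of "\<lambda>m. \<omega> m = 0"] by auto
    with 0 t obtain k where k: "m = Suc k" by (cases m) auto
    have pos: "\<omega> k > 0" using least[of k] path[of k] k by (auto simp: less_le)
    with *[of k] eq fc k \<open>\<omega> m = 0\<close> have "k = j" by simp
    with pos k \<open>\<omega> m = 0\<close> show "\<omega> j > 0 \<and> \<omega> (Suc j) = 0" by simp
  qed
qed

text \<open>Up to a null set the event concerns only the coordinates \<open>j\<close> and
  \<open>j + 1\<close>. One application of the Markov property turns it into
  \<open>level_prob \<mu> 0\<close> evaluated at time \<open>j\<close>.\<close>

lemma emeasure_count_event:
  assumes t: "t > 0"
  shows "emeasure (chain_law \<mu> t) (count_event t j) = level_prob \<mu> j t"
proof -
  have t': "t \<ge> 0" using t by simp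
  note sets_chain_law[OF markov t', measurable_cong]
  define h :: "real \<Rightarrow> real \<Rightarrow> ennreal" where "h x y = indicator {0<..} x * indicator {0} y" for x y
  have [measurable]: "case_prod h \<in> borel_measurable (S \<Otimes>\<^sub>M S)"
  proof -
    have [measurable]: "fst \<in> borel_measurable (S \<Otimes>\<^sub>M S)" "snd \<in> borel_measurable (S \<Otimes>\<^sub>M S)"
      by (rule measurable_compose[OF _ id_S_borel]; measurable)+
    show ?thesis unfolding h_def case_prod_beta by measurable
  qed
  have ce: "count_event t j \<in> sets (chain_law \<mu> t)"
    using count_event_sets sets_chain_law[OF markov t'] by simp
  have "emeasure (chain_law \<mu> t) (count_event t j) = (\<integral>\<^sup>+\<omega>. indicator (count_event t j) \<omega> \<partial>chain_law \<mu> t)"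
    using ce by simp
  also have "\<dots> = (\<integral>\<^sup>+\<omega>. h (\<omega> j) (\<omega> (Suc j)) \<partial>chain_law \<mu> t)"
  proof (rule nn_integral_cong_AE)
    show "AE \<omega> in chain_law \<mu> t. indicator (count_event t j) \<omega> = h (\<omega> j) (\<omega> (Suc j))"
      using AE_chain_path[OF t'] AE_space
    proof eventually_elim
      case (elim \<omega>)
      then have "\<omega> \<in> count_event t j \<longleftrightarrow> \<omega> j > 0 \<and> \<omega> (Suc j) = 0"
        using count_iff_exit[of t \<omega> j] t
        by (auto simp: count_event_def space_chain_law[OF markov t'] space_PiM)
      then show ?case by (auto simp: h_def split: split_indicator)
    qed
  qed
  also have "\<dots> = (\<integral>\<^sup>+\<omega>. (\<integral>\<^sup>+y. h (\<omega> j) y \<partial>\<mu> (\<omega> j)) \<partial>chain_law \<mu> t)"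
    by (rule nn_integral_chain_step[OF markov t']) measurable
  also have "\<dots> = (\<integral>\<^sup>+\<omega>. level_prob \<mu> 0 (\<omega> j) \<partial>chain_law \<mu> t)"
  proof (rule nn_integral_cong)
    fix \<omega> assume "\<omega> \<in> space (chain_law \<mu> t)"
    then have "\<omega> j \<ge> 0" by (auto simp: space_chain_law[OF markov t'])
    then show "(\<integral>\<^sup>+y. h (\<omega> j) y \<partial>\<mu> (\<omega> j)) = level_prob \<mu> 0 (\<omega> j)"
      using sets_kernel[of "\<omega> j" "{0}"] by (simp add: h_def nn_integral_cmult mult.commute)
  qed
  also have "\<dots> = level_prob \<mu> j t"
    using nn_integral_level_prob[OF t', of 0 j] by simp
  finally show ?thesis .
qed

end

text \<open>This eliminates the path space: existence and uniqueness become statements about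
  iterated integrals of the kernel.\<close>

lemma good_kernel_iff:
  "good_kernel \<mu> \<longleftrightarrow> decreasing_kernel \<mu> \<and> (\<forall>t>0. \<forall>j. enn2real (level_prob \<mu> j t) = p j t)"
  by (auto simp: good_kernel_def decreasing_kernel_def measure_def decreasing_kernel.emeasure_count_event)

section \<open>Determinacy\<close>

lemma pochhammer_nonneg_of_nat: "pochhammer (real n) k \<ge> 0"
  by (cases k) (auto simp: pochhammer_prod prod_nonneg)

text \<open>Each factor satisfies \<open>n + k \<le> (k + 1) * (n + 1)\<close>. The bound supplies
  the absolute convergence needed to exchange sums.\<close>

lemma pochhammer_of_nat_le: "pochhammer (real n) k \<le> fact k * (real n + 1) ^ k"
proof (induction k)
  case (Suc k)
  have "pochhammer (real n) (Suc k) = pochhammer (real n) k * (real n + real k)"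
    by (simp add: pochhammer_Suc)
  also have "\<dots> \<le> (fact k * (real n + 1) ^ k) * ((real k + 1) * (real n + 1))"
    by (intro mult_mono Suc) (auto simp: algebra_simps pochhammer_nonneg_of_nat)
  also have "\<dots> = fact (Suc k) * (real n + 1) ^ Suc k" by (simp add: algebra_simps)
  finally show ?case .
qed simp

lemma infsum_stirling_row:
  fixes x :: real
  shows "(\<lambda>j. real (stirling k j) * x ^ j) summable_on UNIV"
    "(\<Sum>\<^sub>\<infinity>j. real (stirling k j) * x ^ j) = pochhammer x k"
proof -
  have *: "((\<lambda>j. real (stirling k j) * x ^ j) has_sum pochhammer x k) UNIV"
    using has_sum_finite[of "{..k}" "\<lambda>j. real (stirling k j) * x ^ j"]
    by (subst has_sum_cong_neutral[where T = "{..k}" and g = "\<lambda>j. real (stirling k j) * x ^ j"])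
      (auto simp: stirling_pochhammer[symmetric])
  show "(\<lambda>j. real (stirling k j) * x ^ j) summable_on UNIV"
    using * by (auto simp: summable_on_def)
  show "(\<Sum>\<^sub>\<infinity>j. real (stirling k j) * x ^ j) = pochhammer x k"
    using * by (rule infsumI)
qed

lemma stirling_le_fact: "stirling k j \<le> fact k"
proof (cases "j \<le> k")
  case True
  then have "stirling k j \<le> (\<Sum>j\<le>k. stirling k j)" by (intro member_le_sum) auto
  then show ?thesis by (simp only: sum_stirling)
qed simp

text \<open>A double series is summed in two orders: by columns it is zero by hypothesis, by rows it
  collapses to a nonzero multiple of \<open>b n\<close>. The growth bound on \<open>b\<close> makes
  the exchange legitimate.\<close>

lemma stirling_transform_injective:
  fixes b :: "nat \<Rightarrow> real"
  assumes bound: "\<And>k. \<bar>b k\<bar> * fact k \<le> B * r ^ k / fact k"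
    and zero: "\<And>j. (\<Sum>k. real (stirling k j) * b k) = 0"
  shows "b n = 0"
proof (induction n rule: less_induct)
  case (less n)
  define f where "f = (\<lambda>(k, j). b k * (real (stirling k j) * (- real n) ^ j))"
  have nf: "norm (f (k, j)) = \<bar>b k\<bar> * (real (stirling k j) * real n ^ j)" for k j
    by (simp add: f_def abs_mult power_abs)
  have "(\<lambda>x. norm (f x)) summable_on (UNIV \<times> UNIV)"
    unfolding Infinite_Sum.abs_summable_on_Sigma_iff
  proof (intro conjI ballI)
    show "(\<lambda>j. norm (f (k, j))) summable_on UNIV" for k
      unfolding nf by (intro summable_on_cmult_right infsum_stirling_row)
    \<comment> \<open>In absolute value the weight \<open>- n\<close> becomes \<open>n\<close>, and
      the row sums are rising factorials of \<open>n\<close>. Their growth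
      \<open>fact k * (n + 1) ^ k\<close> is absorbed by the bound on \<open>b\<close>, leaving an
      exponential series.\<close>
    have eq: "(\<Sum>\<^sub>\<infinity>j. norm (f (k, j))) = \<bar>b k\<bar> * pochhammer (real n) k" for k
      unfolding nf by (simp add: infsum_cmult_right' infsum_stirling_row)
    have "summable (\<lambda>k. \<bar>b k\<bar> * pochhammer (real n) k)"
    proof (rule summable_comparison_test')
      show "summable (\<lambda>k. B * (inverse (fact k) * (r * (real n + 1)) ^ k))"
        by (intro summable_mult summable_exp)
      fix k :: nat
      have "\<bar>b k\<bar> * pochhammer (real n) k \<le> \<bar>b k\<bar> * (fact k * (real n + 1) ^ k)"
        by (intro mult_left_mono pochhammer_of_nat_le) auto
      also have "\<dots> \<le> (B * r ^ k / fact k) * (real n + 1) ^ k"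
        using mult_right_mono[OF bound[of k], of "(real n + 1) ^ k"] by (simp add: mult_ac)
      finally show "norm (\<bar>b k\<bar> * pochhammer (real n) k) \<le> B * (inverse (fact k) * (r * (real n + 1)) ^ k)"
        by (simp only: real_norm_def abs_mult abs_abs abs_of_nonneg[OF pochhammer_nonneg_of_nat] power_mult_distrib divide_inverse mult_ac)
    qed
    then have "(\<lambda>k. \<bar>b k\<bar> * pochhammer (real n) k) summable_on UNIV"
      by (subst summable_on_UNIV_nonneg_real_iff) (auto simp: pochhammer_nonneg_of_nat)
    then show "(\<lambda>k. norm (\<Sum>\<^sub>\<infinity>j. norm (f (k, j)))) summable_on UNIV"
      unfolding eq by (simp add: abs_mult pochhammer_nonneg_of_nat)
  qed
  then have sf: "f summable_on (UNIV \<times> UNIV)" by (rule abs_summable_summable)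
  have col: "(\<Sum>\<^sub>\<infinity>k. f (k, j)) = 0" for j
  proof -
    have "(\<lambda>k. norm (real (stirling k j) * b k)) summable_on UNIV"
    proof -
      have "summable (\<lambda>k. norm (real (stirling k j) * b k))"
      proof (rule summable_comparison_test')
        show "summable (\<lambda>k. B * (inverse (fact k) * r ^ k))"
          by (intro summable_mult summable_exp)
        fix k :: nat
        have "real (stirling k j) \<le> fact k"
          using stirling_le_fact[of k j] by (metis of_nat_fact of_nat_le_iff)
        then have "norm (real (stirling k j) * b k) \<le> \<bar>b k\<bar> * fact k"
          using mult_left_mono[of "real (stirling k j)" "fact k" "\<bar>b k\<bar>"] by (simp add: abs_mult mult.commute)
        also note bound[of k]
        finally show "norm (norm (real (stirling k j) * b k)) \<le> B * (inverse (fact k) * r ^ k)"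
          by (simp add: field_simps)
      qed
      then show ?thesis by (subst summable_on_UNIV_nonneg_real_iff) auto
    qed
    then have s: "(\<lambda>k. real (stirling k j) * b k) summable_on UNIV" by (rule abs_summable_summable)
    then have "((\<lambda>k. real (stirling k j) * b k) sums (\<Sum>\<^sub>\<infinity>k. real (stirling k j) * b k))"
      by (intro has_sum_imp_sums has_sum_infsum)
    with zero[of j] have "(\<Sum>\<^sub>\<infinity>k. real (stirling k j) * b k) = 0" by (simp add: sums_iff)
    moreover have "(\<Sum>\<^sub>\<infinity>k. f (k, j)) = (\<Sum>\<^sub>\<infinity>k. (- real n) ^ j * (real (stirling k j) * b k))"
      by (intro infsum_cong) (simp add: f_def)
    ultimately show ?thesis by (simp add: infsum_cmult_right')
  qed
  have row: "(\<Sum>\<^sub>\<infinity>j. f (k, j)) = b k * pochhammer (- real n) k" for k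
    unfolding f_def by (simp only: prod.case infsum_cmult_right' infsum_stirling_row)
  have "(\<Sum>\<^sub>\<infinity>k. \<Sum>\<^sub>\<infinity>j. f (k, j)) = (\<Sum>\<^sub>\<infinity>j. \<Sum>\<^sub>\<infinity>k. f (k, j))"
    using infsum_swap_banach[of "\<lambda>k j. f (k, j)" UNIV UNIV] sf by simp
  also have "\<dots> = 0" by (simp add: col)
  finally have "(\<Sum>\<^sub>\<infinity>k. b k * pochhammer (- real n) k) = 0" by (simp only: row)
  \<comment> \<open>Terms with \<open>k < n\<close> vanish by the induction hypothesis; for
    \<open>k > n\<close> the rising factorial of \<open>- n\<close> contains the factor 0.\<close>
  moreover have "(\<Sum>\<^sub>\<infinity>k. b k * pochhammer (- real n) k) = (\<Sum>\<^sub>\<infinity>k\<in>{n}. b k * pochhammer (- real n) k)"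
  proof (rule infsum_cong_neutral)
    fix k assume "k \<in> UNIV - {n}"
    then show "b k * pochhammer (- real n) k = 0"
      using less[of k] pochhammer_of_nat_eq_0_lemma[of n k] by (cases "k < n") auto
  qed auto
  moreover have "\<dots> = b n * ((-1) ^ n * fact n)" by (simp add: pochhammer_same)
  ultimately show ?case by simp
qed

section \<open>Exponentially tilted moments and characteristic functions\<close>

definition tilted_moment :: "real measure \<Rightarrow> nat \<Rightarrow> real" where
  "tilted_moment M k = (\<integral>s. exp (- s) * s ^ k \<partial>M)"

locale bounded_law = prob_space M for M :: "real measure" +
  fixes t :: real
  assumes sets_M: "sets M = sets S" and bounded: "AE s in M. s \<le> t"
begin

lemma AE_range: "AE s in M. 0 \<le> s \<and> s \<le> t"
  using bounded AE_space by eventually_elim (simp add: sets_eq_imp_space_eq[OF sets_M])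

lemma measurable_M:
  assumes "f \<in> borel_measurable borel"
  shows "f \<in> borel_measurable M"
proof -
  have "measurable M borel = measurable S borel"
    by (rule measurable_cong_sets[OF sets_M refl])
  then show ?thesis using borel_measurable_S_restrict[OF assms] by blast
qed

lemma AE_integrand: "AE s in M. 0 \<le> exp (- s) * s ^ k \<and> exp (- s) * s ^ k \<le> t ^ k"
  using AE_range
proof eventually_elim
  case (elim s)
  then have "exp (- s) * s ^ k \<le> 1 * t ^ k" by (intro mult_mono power_mono) auto
  with elim show ?case by simp
qed

lemma integrable_moment: "integrable M (\<lambda>s. exp (- s) * s ^ k)"
proof (rule integrable_const_bound)
  show "AE s in M. norm (exp (- s) * s ^ k) \<le> t ^ k"
    using AE_integrand[of k] by eventually_elim auto
qed (rule measurable_M, simp)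

lemma tilted_moment_bounds: "0 \<le> tilted_moment M k" "tilted_moment M k \<le> t ^ k"
proof -
  show "0 \<le> tilted_moment M k"
    unfolding tilted_moment_def using AE_integrand by (intro integral_nonneg_AE) (auto elim: eventually_mono)
  have "tilted_moment M k \<le> (\<integral>s. t ^ k \<partial>M)"
    unfolding tilted_moment_def using AE_integrand
    by (intro integral_mono_AE integrable_moment) (auto elim: eventually_mono)
  then show "tilted_moment M k \<le> t ^ k" by (simp add: prob_space)
qed

text \<open>Almost everywhere the terms are dominated by \<open>t ^ k * norm (c k)\<close>, so sum
  and integral commute. Coefficients are vector-valued in order to cover both the complex series of
  the characteristic function and the real series of \<open>p\<close>.\<close>

lemma integral_power_series:
  fixes c :: "nat \<Rightarrow> 'b :: {banach, second_countable_topology}"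
  assumes c: "summable (\<lambda>k. t ^ k * norm (c k))"
  shows "integrable M (\<lambda>s. \<Sum>k. (exp (- s) * s ^ k) *\<^sub>R c k)"
    "(\<integral>s. (\<Sum>k. (exp (- s) * s ^ k) *\<^sub>R c k) \<partial>M) = (\<Sum>k. tilted_moment M k *\<^sub>R c k)"
proof -
  have i: "integrable M (\<lambda>s. (exp (- s) * s ^ k) *\<^sub>R c k)" for k
    by (intro integrable_scaleR_left integrable_moment)
  have AE: "AE s in M. summable (\<lambda>k. norm ((exp (- s) * s ^ k) *\<^sub>R c k))"
  proof -
    have "AE s in M. \<forall>k. 0 \<le> exp (- s) * s ^ k \<and> exp (- s) * s ^ k \<le> t ^ k"
      using AE_integrand by (simp add: AE_all_countable)
    then show ?thesis
    proof eventually_elim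
      case (elim s)
      show ?case
      proof (rule summable_comparison_test'[OF c])
        fix k show "norm (norm ((exp (- s) * s ^ k) *\<^sub>R c k)) \<le> t ^ k * norm (c k)"
          using elim[rule_format, of k] by (simp add: mult_right_mono)
      qed
    qed
  qed
  have "(\<integral>s. norm ((exp (- s) * s ^ k) *\<^sub>R c k) \<partial>M) = tilted_moment M k * norm (c k)" for k
  proof -
    have "(\<integral>s. norm ((exp (- s) * s ^ k) *\<^sub>R c k) \<partial>M) = (\<integral>s. (exp (- s) * s ^ k) * norm (c k) \<partial>M)"
    proof (rule integral_cong_AE)
      show "AE s in M. norm ((exp (- s) * s ^ k) *\<^sub>R c k) = exp (- s) * s ^ k * norm (c k)"
        using AE_integrand[of k] by eventually_elim simp
    qed (rule measurable_M, simp)+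
    then show ?thesis by (simp add: tilted_moment_def)
  qed
  moreover have "summable (\<lambda>k. tilted_moment M k * norm (c k))"
    using tilted_moment_bounds by (intro summable_comparison_test'[OF c]) (simp add: abs_mult mult_right_mono)
  ultimately have s: "summable (\<lambda>k. \<integral>s. norm ((exp (- s) * s ^ k) *\<^sub>R c k) \<partial>M)"
    by presburger
  show "integrable M (\<lambda>s. \<Sum>k. (exp (- s) * s ^ k) *\<^sub>R c k)"
    by (rule integrable_suminf[OF i AE s])
  have "(\<integral>s. (exp (- s) * s ^ k) *\<^sub>R c k \<partial>M) = tilted_moment M k *\<^sub>R c k" for k
    unfolding tilted_moment_def by (rule integral_scaleR_left) (simp add: integrable_moment)
  then show "(\<integral>s. (\<Sum>k. (exp (- s) * s ^ k) *\<^sub>R c k) \<partial>M) = (\<Sum>k. tilted_moment M k *\<^sub>R c k)"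
    using integral_suminf[OF i AE s] by simp
qed

text \<open>\<open>exp (i x s) = exp (- s) * exp ((1 + i x) s)\<close>; the second factor is expanded into its series.\<close>
lemma char_eq_moment_series:
  "char (distr M borel (\<lambda>x. x)) x = (\<Sum>k. tilted_moment M k *\<^sub>R ((1 + \<i> * of_real x) ^ k /\<^sub>R fact k))"
proof -
  have [measurable]: "(\<lambda>x. x) \<in> borel_measurable M" by (intro measurable_M) simp
  have s: "summable (\<lambda>k. t ^ k * norm ((1 + \<i> * of_real x) ^ k /\<^sub>R fact k))"
    using summable_exp[of "t * norm (1 + \<i> * of_real x)"]
    by (simp add: norm_power power_mult_distrib mult_ac divide_inverse)
  have "char (distr M borel (\<lambda>x. x)) x = (\<integral>s. iexp (x * s) \<partial>M)"
    by (simp add: char_def integral_distr)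
  also have "\<dots> = (\<integral>s. (\<Sum>k. (exp (- s) * s ^ k) *\<^sub>R ((1 + \<i> * of_real x) ^ k /\<^sub>R fact k)) \<partial>M)"
  proof (rule Bochner_Integration.integral_cong[OF refl])
    fix s
    have "iexp (x * s) = exp (- of_real s) * exp (of_real s * (1 + \<i> * of_real x))"
      by (simp add: exp_add[symmetric] algebra_simps)
    also have "exp (of_real s * (1 + \<i> * of_real x)) = (\<Sum>k. (of_real s * (1 + \<i> * of_real x)) ^ k /\<^sub>R fact k)"
      by (simp add: exp_def)
    also have "exp (- of_real s) * \<dots> = (\<Sum>k. exp (- of_real s) * ((of_real s * (1 + \<i> * of_real x)) ^ k /\<^sub>R fact k))"
      by (rule suminf_mult[symmetric]) (rule summable_exp_generic)
    also have "\<dots> = (\<Sum>k. (exp (- s) * s ^ k) *\<^sub>R ((1 + \<i> * of_real x) ^ k /\<^sub>R fact k))"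
      by (intro suminf_cong) (simp add: scaleR_conv_of_real power_mult_distrib exp_of_real[symmetric] mult_ac)
    finally show "iexp (x * s) = (\<Sum>k. (exp (- s) * s ^ k) *\<^sub>R ((1 + \<i> * of_real x) ^ k /\<^sub>R fact k))" .
  qed
  also have "\<dots> = (\<Sum>k. tilted_moment M k *\<^sub>R ((1 + \<i> * of_real x) ^ k /\<^sub>R fact k))"
    by (rule integral_power_series[OF s])
  finally show ?thesis .
qed

end

text \<open>The moment series gives equal characteristic functions, so Levy's theorem identifies the
  images on the Borel line. This descends to \<open>S\<close> because its measurable sets are the
  Borel subsets of the half-line.\<close>

lemma bounded_law_eqI:
  assumes M: "bounded_law M t" and N: "bounded_law N t"
    and eq: "\<And>k. tilted_moment M k = tilted_moment N k"
  shows "M = N"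
proof -
  interpret M: bounded_law M t by fact
  interpret N: bounded_law N t by fact
  have [measurable]: "(\<lambda>x. x) \<in> borel_measurable M" "(\<lambda>x. x) \<in> borel_measurable N"
    by (auto intro: M.measurable_M N.measurable_M)
  have "distr M borel (\<lambda>x. x) = distr N borel (\<lambda>x. x)"
    by (rule Levy_uniqueness)
      (auto simp: M.char_eq_moment_series N.char_eq_moment_series eq
        intro!: M.real_distribution_distr N.real_distribution_distr)
  note distr_eq = this
  show ?thesis
  proof (rule measure_eqI)
    show "sets M = sets N" by (simp add: M.sets_M N.sets_M)
    fix A assume A: "A \<in> sets M"
    then have "A \<in> sets borel" and sub: "A \<subseteq> {0..}"
      by (auto simp: M.sets_M S_def sets_restrict_space_iff)
    with distr_eq have "emeasure (distr M borel (\<lambda>x. x)) A = emeasure (distr N borel (\<lambda>x. x)) A" by simp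
    moreover have "A \<inter> space M = A" "A \<inter> space N = A"
      using sub by (auto simp: sets_eq_imp_space_eq[OF M.sets_M] sets_eq_imp_space_eq[OF N.sets_M])
    ultimately show "emeasure M A = emeasure N A"
      using \<open>A \<in> sets borel\<close> by (simp add: emeasure_distr)
  qed
qed

section \<open>The functions \<open>p\<^sub>j\<close>\<close>

definition stirling_coeff :: "nat \<Rightarrow> nat \<Rightarrow> real" where
  "stirling_coeff j k = real (stirling k j) / (fact k)\<^sup>2"

lemma stirling_coeff_bounds: "0 \<le> stirling_coeff j k" "stirling_coeff j k \<le> inverse (fact k)"
proof -
  have "real (stirling k j) \<le> fact k"
    using stirling_le_fact[of k j] by (metis of_nat_fact of_nat_le_iff)
  then show "stirling_coeff j k \<le> inverse (fact k)"
    by (simp add: stirling_coeff_def power2_eq_square divide_simps)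
qed (simp add: stirling_coeff_def)

lemma summable_stirling_coeff: "summable (\<lambda>k. stirling_coeff j k * x ^ k)"
proof (rule summable_comparison_test')
  show "summable (\<lambda>k. inverse (fact k) * \<bar>x\<bar> ^ k)" by (rule summable_exp)
  show "norm (stirling_coeff j k * x ^ k) \<le> inverse (fact k) * \<bar>x\<bar> ^ k" for k
    using stirling_coeff_bounds[of j k] by (auto simp: abs_mult power_abs intro!: mult_right_mono)
qed

text \<open>This is the function \<open>exp x * p j x\<close>, whose coefficients are
  nonnegative.\<close>

definition stirling_series :: "nat \<Rightarrow> real \<Rightarrow> real" where
  "stirling_series j x = (\<Sum>k. stirling_coeff j k * x ^ k)"

lemma p_eq: "p j x = exp (- x) * stirling_series j x"
  unfolding p_def stirling_series_def stirling_coeff_def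
  by (simp add: power2_eq_square mult.commute)

lemma stirling_series_nonneg: "x \<ge> 0 \<Longrightarrow> stirling_series j x \<ge> 0"
  unfolding stirling_series_def
  by (intro suminf_nonneg summable_stirling_coeff) (simp add: stirling_coeff_bounds)

lemma p_nonneg: "x \<ge> 0 \<Longrightarrow> p j x \<ge> 0"
  by (simp add: p_eq stirling_series_nonneg)

lemma p_0: "p 0 x = exp (- x)"
proof -
  have "stirling_series 0 x = (\<Sum>k\<in>{0}. stirling_coeff 0 k * x ^ k)"
    unfolding stirling_series_def by (rule suminf_finite) (auto simp: stirling_coeff_def)
  then show ?thesis by (simp add: p_eq stirling_coeff_def)
qed

lemma stirling_series_Suc_0: "stirling_series (Suc j) 0 = 0"
  using powser_zero[of "stirling_coeff (Suc j)"] by (simp add: stirling_series_def stirling_coeff_def)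

definition stirling_series_deriv :: "nat \<Rightarrow> real \<Rightarrow> real" where
  "stirling_series_deriv j x = (\<Sum>k. diffs (stirling_coeff j) k * x ^ k)"

lemma DERIV_stirling_series:
  "(stirling_series j has_real_derivative stirling_series_deriv j x) (at x)"
  unfolding stirling_series_def[abs_def] stirling_series_deriv_def
  by (rule termdiffs_strong_converges_everywhere) (rule summable_stirling_coeff)

lemma stirling_series_deriv_nonneg: "x \<ge> 0 \<Longrightarrow> stirling_series_deriv j x \<ge> 0"
  unfolding stirling_series_deriv_def
  by (intro suminf_nonneg termdiff_converges_all summable_stirling_coeff)
    (simp add: diffs_def stirling_coeff_bounds)

lemma continuous_stirling_series_deriv: "continuous_on UNIV (stirling_series_deriv j)"
proof -
  have "(stirling_series_deriv j has_real_derivative (\<Sum>k. diffs (diffs (stirling_coeff j)) k * x ^ k)) (at x)" for x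
    unfolding stirling_series_deriv_def[abs_def]
    by (intro termdiffs_strong_converges_everywhere termdiff_converges_all summable_stirling_coeff)
  then show ?thesis by (auto intro!: DERIV_continuous_on)
qed

lemma continuous_stirling_series: "continuous_on UNIV (stirling_series j)"
  using DERIV_stirling_series by (auto intro!: DERIV_continuous_on)

lemma continuous_p: "continuous_on UNIV (p j)"
proof -
  have "p j = (\<lambda>x. exp (- x) * stirling_series j x)" by (auto simp: p_eq)
  then show ?thesis
    by (auto intro!: continuous_intros continuous_stirling_series)
qed

lemma borel_measurable_p [measurable]: "p j \<in> borel_measurable borel"
  by (rule borel_measurable_continuous_onI[OF continuous_p])

lemma borel_measurable_stirling_series_deriv [measurable]: "stirling_series_deriv j \<in> borel_measurable borel"
  by (rule borel_measurable_continuous_onI[OF continuous_stirling_series_deriv])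

text \<open>The Stirling recurrence is this differential equation linking consecutive indices.\<close>
lemma DERIV_weighted_stirling_series_deriv:
  "((\<lambda>x. x * (exp (- x) * stirling_series_deriv (Suc j) x)) has_real_derivative p j x) (at x)"
proof -
  let ?c = "stirling_coeff (Suc j)"
  \<comment> \<open>These are the coefficients of \<open>x\<close> times the derivative of the
    series: the factor \<open>x\<close> undoes the index shift of \<open>diffs\<close>.\<close>
  define d where "d k = real k * ?c k" for k
  have sum_d: "summable (\<lambda>k. d k * x ^ k)" and D: "x * stirling_series_deriv (Suc j) x = (\<Sum>k. d k * x ^ k)" for x
  proof -
    have "(\<lambda>k. x * (diffs ?c k * x ^ k)) sums (x * stirling_series_deriv (Suc j) x)"
      unfolding stirling_series_deriv_def
      by (intro sums_mult summable_sums termdiff_converges_all summable_stirling_coeff)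
    also have "(\<lambda>k. x * (diffs ?c k * x ^ k)) = (\<lambda>k. d (Suc k) * x ^ Suc k)"
      by (auto simp: d_def diffs_def)
    finally have "(\<lambda>k. d k * x ^ k) sums (x * stirling_series_deriv (Suc j) x)"
      by (subst (asm) sums_Suc_iff) (simp add: d_def)
    then show "summable (\<lambda>k. d k * x ^ k)" "x * stirling_series_deriv (Suc j) x = (\<Sum>k. d k * x ^ k)"
      by (auto simp: sums_iff)
  qed
  have "((\<lambda>x. \<Sum>k. d k * x ^ k) has_real_derivative (\<Sum>k. diffs d k * x ^ k)) (at x)"
    by (rule termdiffs_strong_converges_everywhere) (rule sum_d)
  then have "((\<lambda>x. exp (- x) * (\<Sum>k. d k * x ^ k)) has_real_derivative
      exp (- x) * ((\<Sum>k. diffs d k * x ^ k) - (\<Sum>k. d k * x ^ k))) (at x)"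
    by (auto intro!: derivative_eq_intros simp: algebra_simps)
  also have "(\<Sum>k. diffs d k * x ^ k) - (\<Sum>k. d k * x ^ k) = (\<Sum>k. diffs d k * x ^ k - d k * x ^ k)"
    by (rule suminf_diff) (intro termdiff_converges_all sum_d)+
  also have "\<dots> = stirling_series j x"
    unfolding stirling_series_def
  proof (rule suminf_cong)
    fix k
    have "real k + 1 \<noteq> 0" by linarith
    have "diffs d k = (real k + 1)\<^sup>2 * real (stirling (Suc k) (Suc j)) / ((real k + 1) * fact k)\<^sup>2"
      by (simp add: diffs_def d_def stirling_coeff_def power2_eq_square add.commute)
    also have "\<dots> = real (stirling (Suc k) (Suc j)) / (fact k)\<^sup>2"
      using \<open>real k + 1 \<noteq> 0\<close> by (simp only: power_mult_distrib) simp
    \<comment> \<open>The recurrence \<open>stirling (Suc k) (Suc j) = k * stirling k (Suc j) +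
      stirling k j\<close> enters here; its first summand is cancelled by
      \<open>d k\<close>.\<close>
    finally have "diffs d k - d k = stirling_coeff j k"
      by (simp add: d_def stirling_coeff_def diff_divide_distrib[symmetric])
    then show "diffs d k * x ^ k - d k * x ^ k = stirling_coeff j k * x ^ k"
      by (simp add: left_diff_distrib[symmetric])
  qed
  finally show ?thesis by (simp add: p_eq D[symmetric] mult_ac)
qed

context bounded_law begin

lemma integral_p:
  "integrable M (p j)" "(\<integral>s. p j s \<partial>M) = (\<Sum>k. tilted_moment M k * stirling_coeff j k)"
proof -
  have s: "summable (\<lambda>k. t ^ k * norm (stirling_coeff j k))"
    using summable_stirling_coeff[of j t] stirling_coeff_bounds by (simp add: mult.commute)
  have p: "p j s = (\<Sum>k. (exp (- s) * s ^ k) *\<^sub>R stirling_coeff j k)" for s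
    unfolding p_eq stirling_series_def
    by (subst suminf_mult[symmetric, OF summable_stirling_coeff]) (simp add: mult_ac)
  show "integrable M (p j)" "(\<integral>s. p j s \<partial>M) = (\<Sum>k. tilted_moment M k * stirling_coeff j k)"
    using integral_power_series[OF s] by (simp_all add: p[abs_def])
qed

lemma nn_integral_p: "(\<integral>\<^sup>+s. p j s \<partial>M) = ennreal (\<integral>s. p j s \<partial>M)"
proof (rule nn_integral_eq_integral[OF integral_p(1)])
  show "AE s in M. 0 \<le> p j s" using AE_range by eventually_elim (simp add: p_nonneg)
qed

lemma integral_p_nonneg: "(\<integral>s. p j s \<partial>M) \<ge> 0"
proof (rule integral_nonneg_AE)
  show "AE s in M. 0 \<le> p j s" using AE_range by eventually_elim (simp add: p_nonneg)
qed

lemma summable_moment_stirling: "summable (\<lambda>k. tilted_moment M k * stirling_coeff j k)"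
proof (rule summable_comparison_test'[OF summable_stirling_coeff[of j t]])
  show "norm (tilted_moment M k * stirling_coeff j k) \<le> stirling_coeff j k * t ^ k" for k
    using tilted_moment_bounds[of k] stirling_coeff_bounds[of j k]
      mult_left_mono[of "tilted_moment M k" "t ^ k" "stirling_coeff j k"]
    by (simp add: abs_mult mult.commute)
qed

end

text \<open>Integrals of the \<open>p j\<close> are Stirling transforms of the tilted moments, so
  injectivity of the transform recovers the moments and these recover the law.\<close>

lemma bounded_law_eqI_p:
  assumes M: "bounded_law M t" and N: "bounded_law N t"
    and eq: "\<And>j. (\<integral>\<^sup>+s. p j s \<partial>M) = (\<integral>\<^sup>+s. p j s \<partial>N)"
  shows "M = N"
proof -
  interpret M: bounded_law M t by fact
  interpret N: bounded_law N t by fact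
  \<comment> \<open>Both moments lie between 0 and \<open>t ^ k\<close>, so the growth bound holds
    with \<open>B = 1\<close> and \<open>r = t\<close>.\<close>
  define b where "b k = (tilted_moment M k - tilted_moment N k) / (fact k)\<^sup>2" for k
  have "b k = 0" for k
  proof (rule stirling_transform_injective)
    fix k
    have "\<bar>tilted_moment M k - tilted_moment N k\<bar> \<le> t ^ k"
      using M.tilted_moment_bounds[of k] N.tilted_moment_bounds[of k] by linarith
    then show "\<bar>b k\<bar> * fact k \<le> 1 * t ^ k / fact k"
      by (simp add: b_def abs_divide power2_eq_square divide_simps)
  next
    fix j
    have "(\<integral>s. p j s \<partial>M) = (\<integral>s. p j s \<partial>N)"
      using eq[of j] M.integral_p_nonneg N.integral_p_nonneg
      by (simp add: M.nn_integral_p N.nn_integral_p)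
    then have "0 = (\<Sum>k. tilted_moment M k * stirling_coeff j k - tilted_moment N k * stirling_coeff j k)"
      using suminf_diff[OF M.summable_moment_stirling N.summable_moment_stirling, of j j]
      by (simp add: M.integral_p N.integral_p)
    also have "\<dots> = (\<Sum>k. real (stirling k j) * b k)"
      by (intro suminf_cong) (simp add: b_def stirling_coeff_def field_simps)
    finally show "(\<Sum>k. real (stirling k j) * b k) = 0" by simp
  qed
  then have "tilted_moment M k = tilted_moment N k" for k by (simp add: b_def)
  with M N show ?thesis by (rule bounded_law_eqI)
qed

section \<open>The kernel\<close>

definition exp_unif :: "(real \<times> real) measure" where
  "exp_unif = density lborel (exponential_density 1) \<Otimes>\<^sub>M uniform_measure lborel {0..1}"

text \<open>The outer \<open>max 0 v\<close> only makes the map \<open>S\<close>-valued off the support of the uniform law.\<close>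
definition kernel :: "real \<Rightarrow> real measure" where
  "kernel t = distr exp_unif S (\<lambda>(x, v). max 0 v * max 0 (t - x))"

lemma prob_space_unif: "prob_space (uniform_measure lborel {0..1::real})"
  by (rule prob_space_uniform_measure) auto

lemma prob_space_exp_unif: "prob_space exp_unif"
proof -
  interpret E: prob_space "density lborel (exponential_density 1)"
    by (rule prob_space_exponential_density) simp
  interpret U: prob_space "uniform_measure lborel {0..1::real}" by (rule prob_space_unif)
  interpret pair_prob_space "density lborel (exponential_density 1)" "uniform_measure lborel {0..1::real}" ..
  show ?thesis unfolding exp_unif_def by (rule prob_space_axioms)
qed

lemma sets_exp_unif [measurable_cong]: "sets exp_unif = sets (borel \<Otimes>\<^sub>M borel)"
  unfolding exp_unif_def by (intro sets_pair_measure_cong) auto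

text \<open>Measurability jointly in \<open>t\<close> and the random pair is what makes the image
  laws depend measurably on \<open>t\<close>.\<close>

lemma measurable_kernel_map: "(\<lambda>(t, x, v). max 0 v * max 0 (t - x)) \<in> measurable (S \<Otimes>\<^sub>M exp_unif) S"
proof -
  have [measurable]: "fst \<in> borel_measurable (S \<Otimes>\<^sub>M exp_unif)"
    by (rule measurable_compose[OF _ id_S_borel]) measurable
  have "(\<lambda>z. max 0 (snd (snd z)) * max 0 (fst z - fst (snd z))) \<in> borel_measurable (S \<Otimes>\<^sub>M exp_unif)"
    by measurable
  then show ?thesis unfolding S_def by (intro measurable_restrict_space2) (auto simp: case_prod_beta)
qed

lemma measurable_kernel_map': "t \<ge> 0 \<Longrightarrow> (\<lambda>(x, v). max 0 v * max 0 (t - x)) \<in> measurable exp_unif S"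
  using measurable_compose[OF measurable_Pair1' measurable_kernel_map, of t] by (simp add: case_prod_beta')

lemma markov_kernel_kernel: "markov_kernel kernel"
  unfolding markov_kernel_def kernel_def
proof (rule measurable_distr_prob_space2)
  show "(\<lambda>x. exp_unif) \<in> measurable S (prob_algebra exp_unif)"
    by (simp add: prob_space_exp_unif space_prob_algebra)
qed (use measurable_kernel_map in simp)

text \<open>Tonelli with the uniform variable inside and the exponential one outside. The
  computations with the kernel below start from this formula.\<close>

lemma nn_integral_kernel:
  assumes t: "t \<ge> 0" and f[measurable]: "f \<in> borel_measurable S"
  shows "(\<integral>\<^sup>+y. f y \<partial>kernel t) =
    (\<integral>\<^sup>+x. (\<integral>\<^sup>+v. f (max 0 v * max 0 (t - x)) * indicator {0..1} v \<partial>lborel) * (ennreal (exp (- x)) * indicator {0..} x) \<partial>lborel)"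
proof -
  note measurable_kernel_map'[OF t, measurable]
  interpret U: prob_space "uniform_measure lborel {0..1::real}" by (rule prob_space_unif)
  define g where "g x v = f (max 0 v * max 0 (t - x))" for x v
  have g[measurable]: "case_prod g \<in> borel_measurable exp_unif"
    unfolding g_def using measurable_compose[OF measurable_kernel_map'[OF t] f] by (simp add: case_prod_beta')
  have g'[measurable]: "case_prod g \<in> borel_measurable (borel \<Otimes>\<^sub>M borel)"
    using g by (simp add: measurable_cong_sets[OF sets_exp_unif refl])
  have gx: "g x \<in> borel_measurable lborel" for x
    using measurable_Pair2[OF g', of x] by simp
  have g_int: "(\<lambda>x. \<integral>\<^sup>+v. g x v * indicator {0..1} v \<partial>lborel) \<in> borel_measurable borel"
  proof -
    have "(\<lambda>z. case_prod g z * indicator {0..1} (snd z)) \<in> borel_measurable (borel \<Otimes>\<^sub>M lborel)"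
      using g' by measurable
    then show ?thesis
      by (intro lborel.borel_measurable_nn_integral) (simp add: case_prod_beta')
  qed
  have "(\<integral>\<^sup>+y. f y \<partial>kernel t) = (\<integral>\<^sup>+z. case_prod g z \<partial>exp_unif)"
    unfolding kernel_def
    by (subst nn_integral_distr[OF measurable_kernel_map'[OF t]]) (auto simp: g_def intro!: nn_integral_cong)
  also have "\<dots> = (\<integral>\<^sup>+x. (\<integral>\<^sup>+v. g x v \<partial>uniform_measure lborel {0..1}) \<partial>density lborel (exponential_density 1))"
    unfolding exp_unif_def
    by (subst U.nn_integral_fst[symmetric]) (use g in \<open>auto simp: exp_unif_def\<close>)
  also have "\<dots> = (\<integral>\<^sup>+x. (\<integral>\<^sup>+v. g x v * indicator {0..1} v \<partial>lborel) \<partial>density lborel (exponential_density 1))"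
    using gx by (intro nn_integral_cong) (simp add: nn_integral_uniform_measure divide_ennreal_def)
  also have "\<dots> = (\<integral>\<^sup>+x. (\<integral>\<^sup>+v. g x v * indicator {0..1} v \<partial>lborel) * (ennreal (exp (- x)) * indicator {0..} x) \<partial>lborel)"
  proof (subst nn_integral_density)
    show "(\<integral>\<^sup>+x. ennreal (exponential_density 1 x) * (\<integral>\<^sup>+v. g x v * indicator {0..1} v \<partial>lborel) \<partial>lborel) =
        (\<integral>\<^sup>+x. (\<integral>\<^sup>+v. g x v * indicator {0..1} v \<partial>lborel) * (ennreal (exp (- x)) * indicator {0..} x) \<partial>lborel)"
      by (intro nn_integral_cong) (auto simp: exponential_density_def mult.commute split: split_indicator)
  qed (use g_int in auto)
  finally show ?thesis by (simp add: g_def)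
qed

lemma nn_integral_exp_Ici: "a \<ge> 0 \<Longrightarrow> (\<integral>\<^sup>+x. ennreal (exp (- x)) * indicator {a..} x \<partial>lborel) = ennreal (exp (- a))"
proof -
  have "((\<lambda>x::real. - exp (- x)) \<longlongrightarrow> - 0) at_top"
    by (intro tendsto_minus filterlim_compose[OF exp_at_bot] filterlim_uminus_at_bot_at_top)
  then show ?thesis
    by (subst nn_integral_FTC_atLeast[where F = "\<lambda>x. - exp (- x)" and T = 0])
      (auto intro!: derivative_eq_intros)
qed

lemma nn_integral_unit_interval: "(\<integral>\<^sup>+v. c * indicator {0..1::real} v \<partial>lborel) = c"
  by (subst nn_integral_cmult_indicator) auto

lemma emeasure_kernel:
  assumes "t \<ge> 0" "A \<in> sets borel" "A \<subseteq> {0..}"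
  shows "emeasure (kernel t) A = (\<integral>\<^sup>+y. indicator A y \<partial>kernel t)"
  using assms by (simp add: kernel_def S_def sets_restrict_space_iff)

lemma kernel_absorbing: "emeasure (kernel 0) {0} = 1"
proof -
  have "emeasure (kernel 0) {0} = (\<integral>\<^sup>+x. 1 * (ennreal (exp (- x)) * indicator {0..} x) \<partial>lborel)"
    by (subst emeasure_kernel; (subst nn_integral_kernel)?)
      (auto intro!: nn_integral_cong indicator_S simp: nn_integral_unit_interval max_def split: split_indicator)
  then show ?thesis by (simp add: nn_integral_exp_Ici)
qed

lemma kernel_decreasing:
  assumes t: "t > 0" shows "emeasure (kernel t) {0..<t} = 1"
proof -
  have "emeasure (kernel t) {0..<t} = (\<integral>\<^sup>+x. (\<integral>\<^sup>+v. indicator {0..<t} (max 0 v * max 0 (t - x)) * indicator {0..1} v \<partial>lborel) *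
      (ennreal (exp (- x)) * indicator {0..} x) \<partial>lborel)"
    using t by (subst emeasure_kernel) (auto intro!: nn_integral_kernel indicator_S)
  also have "\<dots> = (\<integral>\<^sup>+x. ennreal (exp (- x)) * indicator {0..} x \<partial>lborel)"
  proof (rule nn_integral_cong_AE)
    show "AE x in lborel. (\<integral>\<^sup>+v. indicator {0..<t} (max 0 v * max 0 (t - x)) * indicator {0..1} v \<partial>lborel) *
      (ennreal (exp (- x)) * indicator {0..} x) = ennreal (exp (- x)) * indicator {0..} x"
      \<comment> \<open>At \<open>x = 0\<close> the value \<open>t\<close> is attained for
        \<open>v = 1\<close>, so this null set has to be left out.\<close>
      using AE_lborel_singleton[of "0::real"]
    proof eventually_elim
      case (elim x)
      show ?case
      proof (cases "x > 0")
        case True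
        have "max 0 v * max 0 (t - x) < t" if "v \<in> {0..1}" for v
        proof -
          have "max 0 v * max 0 (t - x) \<le> 1 * max 0 (t - x)" using that by (intro mult_right_mono) auto
          also have "\<dots> < t" using True t by simp
          finally show ?thesis .
        qed
        then have "(\<integral>\<^sup>+v. indicator {0..<t} (max 0 v * max 0 (t - x)) * indicator {0..1} v \<partial>lborel) = (\<integral>\<^sup>+v. 1 * indicator {0..1::real} v \<partial>lborel)"
          by (intro nn_integral_cong) (auto split: split_indicator)
        also have "\<dots> = 1" by (rule nn_integral_unit_interval)
        finally show ?thesis by simp
      qed (use elim in auto)
    qed
  qed
  also have "\<dots> = 1" by (simp add: nn_integral_exp_Ici)
  finally show ?thesis .
qed

text \<open>Apart from the null event that the uniform variable is 0, the product vanishes exactly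
  when the exponential variable is at least \<open>t\<close>.\<close>

lemma emeasure_kernel_0:
  assumes t: "t > 0"
  shows "emeasure (kernel t) {0} = ennreal (exp (- t))"
proof -
  have "emeasure (kernel t) {0} = (\<integral>\<^sup>+x. (\<integral>\<^sup>+v. indicator {0} (max 0 v * max 0 (t - x)) * indicator {0..1} v \<partial>lborel) *
      (ennreal (exp (- x)) * indicator {0..} x) \<partial>lborel)"
    using t by (subst emeasure_kernel) (auto intro!: nn_integral_kernel indicator_S)
  also have "\<dots> = (\<integral>\<^sup>+x. ennreal (exp (- x)) * indicator {t..} x \<partial>lborel)"
  proof (rule nn_integral_cong)
    fix x :: real
    show "(\<integral>\<^sup>+v. indicator {0} (max 0 v * max 0 (t - x)) * indicator {0..1} v \<partial>lborel) *
      (ennreal (exp (- x)) * indicator {0..} x) = ennreal (exp (- x)) * indicator {t..} x"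
    proof (cases "x < t")
      case True
      have "(\<integral>\<^sup>+v. indicator {0} (max 0 v * max 0 (t - x)) * indicator {0..1} v \<partial>lborel) = (\<integral>\<^sup>+v. (0 :: ennreal) \<partial>(lborel :: real measure))"
      proof (rule nn_integral_cong_AE)
        show "AE v in lborel. indicator {0} (max 0 v * max 0 (t - x)) * indicator {0..1} v = (0 :: ennreal)"
          using AE_lborel_singleton[of "0::real"]
          by eventually_elim (use True in \<open>auto simp: max_def split: split_indicator\<close>)
      qed
      with True show ?thesis by simp
    next
      case False
      then have "(\<integral>\<^sup>+v. indicator {0} (max 0 v * max 0 (t - x)) * indicator {0..1} v \<partial>lborel) = (\<integral>\<^sup>+v. 1 * indicator {0..1::real} v \<partial>lborel)"
        by (intro nn_integral_cong) (auto simp: max_def split: split_indicator)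
      also have "\<dots> = 1" by (rule nn_integral_unit_interval)
      finally show ?thesis using False t by simp
    qed
  qed
  also have "\<dots> = ennreal (exp (- t))" using t by (simp add: nn_integral_exp_Ici)
  finally show ?thesis .
qed

lemma decreasing_kernel_kernel: "decreasing_kernel kernel"
  by (simp add: decreasing_kernel_def markov_kernel_kernel kernel_absorbing kernel_decreasing)

section \<open>Level probabilities of the kernel\<close>

lemma nn_integral_p_scaled:
  assumes u: "u > 0"
  shows "(\<integral>\<^sup>+v. ennreal (p j (v * u)) * indicator {0..1} v \<partial>lborel) =
    ennreal (exp (- u) * stirling_series_deriv (Suc j) u)"
proof -
  \<comment> \<open>By the differential equation \<open>Q\<close> is an antiderivative of
    \<open>p j\<close>. It vanishes at 0, and dividing \<open>Q u\<close> by \<open>u\<close>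
    cancels its leading factor.\<close>
  define Q where "Q x = x * (exp (- x) * stirling_series_deriv (Suc j) x)" for x
  have "(\<integral>\<^sup>+v. ennreal (p j (v * u)) * indicator {0..1} v \<partial>lborel) = ennreal (Q (1 * u) / u - Q (0 * u) / u)"
  proof (rule nn_integral_FTC_Icc[where F = "\<lambda>v. Q (v * u) / u"])
    fix v :: real
    assume "v \<in> {0..1}"
    with u show "0 \<le> p j (v * u)" by (simp add: p_nonneg)
  next
    fix v :: real
    have "(Q has_real_derivative p j (v * u)) (at (v * u))"
      unfolding Q_def[abs_def] by (rule DERIV_weighted_stirling_series_deriv)
    moreover have "((\<lambda>v. v * u) has_real_derivative u) (at v)"
      by (auto intro!: derivative_eq_intros)
    ultimately have "((\<lambda>v. Q (v * u)) has_real_derivative p j (v * u) * u) (at v)"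
      by (rule DERIV_chain2)
    from DERIV_cdivide[OF this, of u] show "((\<lambda>v. Q (v * u) / u) has_real_derivative p j (v * u)) (at v)"
      using u by simp
  qed auto
  then show ?thesis using u by (simp add: Q_def)
qed

text \<open>The uniform average of \<open>p j\<close> produces \<open>exp (- (t - x))\<close> times
  a derivative. The exponential density turns the first factor into the constant
  \<open>exp (- t)\<close>, and integrating the derivative over \<open>x\<close> gives
  \<open>stirling_series (Suc j) t\<close>.\<close>

lemma level_prob_kernel:
  "t \<ge> 0 \<Longrightarrow> level_prob kernel j t = (if t > 0 then ennreal (p j t) else 0)"
proof (induction j arbitrary: t)
  case 0
  then show ?case by (auto simp: emeasure_kernel_0 p_0)
next
  case (Suc j)
  show ?case
  proof (cases "t > 0")
    case False
    with Suc.prems have "t = 0" by simp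
    then show ?thesis using decreasing_kernel.level_prob_at_0[OF decreasing_kernel_kernel, of "Suc j"] by simp
  next
    case True
    define R where "R = stirling_series_deriv (Suc j)"
    have "level_prob kernel (Suc j) t = (\<integral>\<^sup>+x. (\<integral>\<^sup>+v. level_prob kernel j (max 0 v * max 0 (t - x)) * indicator {0..1} v \<partial>lborel) *
      (ennreal (exp (- x)) * indicator {0..} x) \<partial>lborel)"
      using True by (simp add: nn_integral_kernel measurable_level_prob markov_kernel_kernel)
    also have "\<dots> = (\<integral>\<^sup>+x. ennreal (exp (- t) * R (t - x)) * indicator {0..t} x \<partial>lborel)"
    proof (rule nn_integral_cong_AE)
      show "AE x in lborel. (\<integral>\<^sup>+v. level_prob kernel j (max 0 v * max 0 (t - x)) * indicator {0..1} v \<partial>lborel) *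
          (ennreal (exp (- x)) * indicator {0..} x) = ennreal (exp (- t) * R (t - x)) * indicator {0..t} x"
        \<comment> \<open>At \<open>x = t\<close> the left side is 0, but the right side is positive
          when \<open>j = 0\<close>.\<close>
        using AE_lborel_singleton[of t]
      proof eventually_elim
        case (elim x)
        show ?case
        proof (cases "x < t")
          case True
          have "(\<integral>\<^sup>+v. level_prob kernel j (max 0 v * max 0 (t - x)) * indicator {0..1} v \<partial>lborel) =
              (\<integral>\<^sup>+v. ennreal (p j (v * (t - x))) * indicator {0..1} v \<partial>lborel)"
          proof (rule nn_integral_cong_AE)
            show "AE v in lborel. level_prob kernel j (max 0 v * max 0 (t - x)) * indicator {0..1} v =
                ennreal (p j (v * (t - x))) * indicator {0..1} v"
              \<comment> \<open>At \<open>v = 0\<close> the two integrands may differ: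
                \<open>level_prob\<close> is 0 at the origin, whereas
                \<open>p 0 0 = 1\<close>.\<close>
              using AE_lborel_singleton[of "0::real"]
              by eventually_elim (use True in \<open>auto simp: Suc.IH max_def split: split_indicator\<close>)
          qed
          also have "\<dots> = ennreal (exp (- (t - x)) * R (t - x))"
            unfolding R_def using True by (intro nn_integral_p_scaled) simp
          finally have inner: "(\<integral>\<^sup>+v. level_prob kernel j (max 0 v * max 0 (t - x)) * indicator {0..1} v \<partial>lborel) =
              ennreal (exp (- (t - x)) * R (t - x))" .
          have "R (t - x) \<ge> 0" using True by (simp add: R_def stirling_series_deriv_nonneg)
          then have "ennreal (exp (- (t - x)) * R (t - x)) * ennreal (exp (- x)) = ennreal (exp (- t) * R (t - x))"
            by (simp add: ennreal_mult'[symmetric] mult.commute mult.left_commute exp_add[symmetric])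
          with True show ?thesis unfolding inner by (auto split: split_indicator)
        next
          case False
          then have "max 0 (t - x) = 0" by simp
          with False elim show ?thesis by (simp add: decreasing_kernel.level_prob_at_0[OF decreasing_kernel_kernel])
        qed
      qed
    qed
    also have "\<dots> = ennreal (- exp (- t) * stirling_series (Suc j) (t - t) - (- exp (- t) * stirling_series (Suc j) (t - 0)))"
    proof (rule nn_integral_FTC_Icc[where F = "\<lambda>x. - exp (- t) * stirling_series (Suc j) (t - x)"])
      fix x :: real
      assume "x \<in> {0..t}"
      then show "0 \<le> exp (- t) * R (t - x)" by (simp add: R_def stirling_series_deriv_nonneg)
    next
      fix x :: real
      have "((\<lambda>x. stirling_series (Suc j) (t - x)) has_real_derivative R (t - x) * (- 1)) (at x)"
        unfolding R_def by (rule DERIV_chain2[OF DERIV_stirling_series]) (auto intro!: derivative_eq_intros)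
      from DERIV_cmult[OF this, of "- exp (- t)"]
      show "((\<lambda>x. - exp (- t) * stirling_series (Suc j) (t - x)) has_real_derivative exp (- t) * R (t - x)) (at x)"
        by simp
    qed (use True in \<open>auto simp: R_def\<close>)
    also have "\<dots> = ennreal (p (Suc j) t)" by (simp add: stirling_series_Suc_0 p_eq)
    finally show ?thesis using True by simp
  qed
qed

lemma good_kernel_kernel: "good_kernel kernel"
  unfolding good_kernel_iff using decreasing_kernel_kernel
  by (auto simp: level_prob_kernel p_nonneg)

section \<open>Uniqueness of the kernel\<close>

lemma good_kernel_level_prob:
  assumes "good_kernel \<mu>" "t > 0"
  shows "level_prob \<mu> j t = ennreal (p j t)"
proof -
  interpret decreasing_kernel \<mu> using assms by (simp add: good_kernel_iff)
  interpret L: prob_space "chain_law \<mu> t" using assms markov by (intro prob_space_chain_law) auto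
  \<comment> \<open>\<open>enn2real\<close> sends infinity to 0, so finiteness has to be known
    before it can be inverted. It holds because the value is the probability of a chain
    event.\<close>
  have "level_prob \<mu> j t \<noteq> \<infinity>"
    using emeasure_count_event[OF \<open>t > 0\<close>, of j] L.emeasure_finite[of "count_event t j"] by simp
  moreover have "enn2real (level_prob \<mu> j t) = p j t" using assms by (simp add: good_kernel_iff)
  ultimately show ?thesis by (metis ennreal_enn2real_if infinity_ennreal_def)
qed

lemma good_kernel_bounded_law:
  assumes "good_kernel \<mu>" "t > 0"
  shows "bounded_law (\<mu> t) t"
proof -
  interpret decreasing_kernel \<mu> using assms by (simp add: good_kernel_iff)
  interpret prob_space "\<mu> t" using assms markov by (intro markov_kernelD) auto
  show ?thesis
  proof
    show "sets (\<mu> t) = sets S" using assms markov by (intro markov_kernelD) auto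
    show "AE s in \<mu> t. s \<le> t" using AE_decreasing[OF \<open>t > 0\<close>] by eventually_elim simp
  qed
qed

text \<open>\<open>level_prob \<mu> j\<close> agrees with \<open>p j\<close> at positive states but
  is 0 at the origin. The second summand restores the contribution of the atom at 0, whose mass is
  \<open>p 0 t\<close>. The right side does not mention the kernel, which is what uniqueness rests
  on.\<close>

lemma good_kernel_nn_integral_p:
  assumes \<mu>: "good_kernel \<mu>" and t: "t > 0"
  shows "(\<integral>\<^sup>+s. p j s \<partial>\<mu> t) = ennreal (p (Suc j) t) + ennreal (p j 0) * ennreal (p 0 t)"
proof -
  interpret decreasing_kernel \<mu> using assms by (simp add: good_kernel_iff)
  have sp: "space (\<mu> t) = {0..}" and st: "sets (\<mu> t) = sets S"
    using t by (simp_all add: markov_kernelD[OF markov])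
  have [measurable]: "{0} \<in> sets (\<mu> t)" using t by (intro sets_kernel) auto
  have m: "level_prob \<mu> j \<in> borel_measurable (\<mu> t)"
    using measurable_level_prob[OF markov, of j] measurable_cong_sets[OF st refl, of "borel :: ennreal measure"] by blast
  have "(\<integral>\<^sup>+s. p j s \<partial>\<mu> t) = (\<integral>\<^sup>+s. level_prob \<mu> j s + ennreal (p j 0) * indicator {0} s \<partial>\<mu> t)"
  proof (rule nn_integral_cong)
    fix s assume "s \<in> space (\<mu> t)"
    then have "s \<ge> 0" by (simp add: sp)
    then show "ennreal (p j s) = level_prob \<mu> j s + ennreal (p j 0) * indicator {0} s"
      by (cases "s = 0") (simp_all add: level_prob_at_0 good_kernel_level_prob[OF \<mu>])
  qed
  also have "\<dots> = level_prob \<mu> (Suc j) t + ennreal (p j 0) * emeasure (\<mu> t) {0}"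
    using m by (simp add: nn_integral_add nn_integral_cmult_indicator)
  also have "emeasure (\<mu> t) {0} = level_prob \<mu> 0 t" using t by simp
  finally show ?thesis by (simp only: good_kernel_level_prob[OF \<mu> t])
qed

lemma good_kernel_unique:
  assumes \<mu>: "good_kernel \<mu>" and \<nu>: "good_kernel \<nu>" and "t \<ge> 0"
  shows "\<mu> t = \<nu> t"
proof (cases "t = 0")
  case False
  with \<open>t \<ge> 0\<close> have t: "t > 0" by simp
  show ?thesis
    using good_kernel_bounded_law[OF \<mu> t] good_kernel_bounded_law[OF \<nu> t]
    by (rule bounded_law_eqI_p) (simp add: good_kernel_nn_integral_p[OF _ t] \<mu> \<nu>)
next
  case True
  interpret M: decreasing_kernel \<mu> using \<mu> by (simp add: good_kernel_iff)
  interpret N: decreasing_kernel \<nu> using \<nu> by (simp add: good_kernel_iff)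
  \<comment> \<open>The counting condition concerns only \<open>t > 0\<close>; at 0 absorption alone
    forces the Dirac law.\<close>
  have dirac: "\<kappa> 0 = return S 0" if "decreasing_kernel \<kappa>" for \<kappa>
  proof -
    interpret decreasing_kernel \<kappa> by fact
    interpret prob_space "\<kappa> 0" by (rule markov_kernelD[OF markov]) simp
    have s: "sets (\<kappa> 0) = sets S" by (rule markov_kernelD[OF markov]) simp
    show ?thesis
    proof (rule measure_eqI)
      fix A assume A: "A \<in> sets (\<kappa> 0)"
      have "emeasure (\<kappa> 0) A = (\<integral>\<^sup>+y. indicator A y \<partial>\<kappa> 0)" using A by simp
      also have "\<dots> = (\<integral>\<^sup>+y. indicator A 0 \<partial>\<kappa> 0)"
        using AE_absorbing by (intro nn_integral_cong_AE) (auto elim: eventually_mono)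
      finally show "emeasure (\<kappa> 0) A = emeasure (return S 0) A"
        using A s by (simp add: emeasure_space_1)
    qed (simp add: s)
  qed
  show ?thesis using True dirac[OF M.decreasing_kernel_axioms] dirac[OF N.decreasing_kernel_axioms] by simp
qed

theorem theorem2:
  shows "(\<exists>\<mu>. good_kernel \<mu>) \<and>
         (\<forall>\<mu> \<nu>. good_kernel \<mu> \<and> good_kernel \<nu> \<longrightarrow> (\<forall>t\<ge>0. \<mu> t = \<nu> t))"
  using good_kernel_kernel good_kernel_unique by blast

end
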